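(* Let $\ell\ge 1$ be an integer. The map $$E:(S\oplus V)^\ell\longrightarrow \mathbb{R}_{0,n},\qquad E(u_1,\dots,u_\ell)=\frac{1}{\ell!}\sum_{\sigma\in\mathfrak S_\ell}u_{\sigma(1)}u_{\sigma(2)}\cdots u_{\sigma(\ell)},$$ where the products are taken in the Clifford algebra $\mathbb{R}_{0,n}$ and $\mathfrak S_\ell$ is the group of all permutations of $\{1,\dots,\ell\}$, is $\mathbb{R}$-multilinear and symmetric, and it takes its values in $S\oplus V$.
   Context: $V$ is a real vector space of dimension $n$ with a negative definite quadratic form, and $\mathbb{R}_{0,n}$ is its Clifford algebra, generated by an orthonormal basis $e_1,\dots,e_n$ of $V$ with relations $e_ie_j+e_je_i=-2\delta_{ij}$ for $1\le i,j\le n$. $S\cong\mathbb{R}$ denotes the scalars in $\mathbb{R}_{0,n}$ and $e_0=1$. Elements of the subspace $S\oplus V=\mathrm{span}(e_0,e_1,\dots,e_n)$ are called paravectors. *)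

theory Defs
  imports Complex_Main "HOL-Library.Poly_Mapping" "HOL-Library.Type_Length" "HOL-Library.FuncSet"
    "HOL-Combinatorics.Permutations"
begin

section \<open>The free real algebra on \<open>n\<close> generators\<close>

text \<open>
  The dimension \<open>n\<close> is carried by a type \<open>'n :: len0\<close> as \<open>LENGTH('n)\<close>; the class \<^class>\<open>len0\<close>
  puts no condition on this number, so every natural number, including \<open>0\<close>, is covered.
  Words in the letters \<open>1, \<dots>, n\<close> form a free monoid under concatenation (written additively, as
  \<^theory>\<open>HOL-Library.Poly_Mapping\<close> requires); its monoid algebra
  \<open>'n clifford_word \<Rightarrow>\<^sub>0 real\<close> is the free associative unital real algebra on \<open>n\<close> generators.
\<close>

typedef (overloaded) 'n clifford_word = "{w :: nat list. set w \<subseteq> {1..LENGTH('n::len0)}}"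
  by (rule exI[of _ "[]"]) simp

setup_lifting type_definition_clifford_word

instantiation clifford_word :: (len0) monoid_add
begin
lift_definition zero_clifford_word :: "'a clifford_word" is "[]" by simp
lift_definition plus_clifford_word :: "'a clifford_word \<Rightarrow> 'a clifford_word \<Rightarrow> 'a clifford_word"
  is "(@)" by simp
instance by standard (transfer; simp)+
end

definition generator :: "nat \<Rightarrow> 'n::len0 clifford_word \<Rightarrow>\<^sub>0 real" where
  "generator i = Poly_Mapping.single (Abs_clifford_word [i]) 1"

section \<open>The Clifford algebra \<open>\<real>\<^bsub>0,n\<^esub>\<close>\<close>

text \<open>
  The two-sided ideal generated by the elements \<open>e\<^sub>i e\<^sub>j + e\<^sub>j e\<^sub>i + 2 \<delta>\<^sub>i\<^sub>j\<close>, \<open>1 \<le> i, j \<le> n\<close>.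
\<close>

inductive_set clifford_ideal :: "('n::len0 clifford_word \<Rightarrow>\<^sub>0 real) set" where
  zero: "0 \<in> clifford_ideal"
| relation: "i \<in> {1..LENGTH('n)} \<Longrightarrow> j \<in> {1..LENGTH('n)} \<Longrightarrow>
    generator i * generator j + generator j * generator i + (if i = j then 2 else 0) \<in> clifford_ideal"
| add: "x \<in> clifford_ideal \<Longrightarrow> y \<in> clifford_ideal \<Longrightarrow> x + y \<in> clifford_ideal"
| mult_left: "x \<in> clifford_ideal \<Longrightarrow> a * x \<in> clifford_ideal"
| mult_right: "x \<in> clifford_ideal \<Longrightarrow> x * a \<in> clifford_ideal"

lemma clifford_ideal_uminus: "x \<in> clifford_ideal \<Longrightarrow> - x \<in> clifford_ideal"
  using clifford_ideal.mult_left[of x "- 1"] by simp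

lemma clifford_ideal_diff: "x \<in> clifford_ideal \<Longrightarrow> y \<in> clifford_ideal \<Longrightarrow> x - y \<in> clifford_ideal"
  using clifford_ideal.add[OF _ clifford_ideal_uminus, of x y] by simp

lemma poly_mapping_single_induct [case_names zero add]:
  fixes p :: "'a \<Rightarrow>\<^sub>0 'b::monoid_add"
  assumes "P 0" and "\<And>p a b. P p \<Longrightarrow> P (Poly_Mapping.single a b + p)"
  shows "P p"
proof (induction p rule: update_induct)
  case const
  then show ?case using assms(1) by simp
next
  case (update f a b)
  have "Poly_Mapping.update a b f = Poly_Mapping.single a b + f"
    by (rule poly_mapping_eqI)
      (use update in \<open>auto simp: lookup_update lookup_add lookup_single when_def in_keys_iff\<close>)
  then show ?case using assms(2) update by simp
qed

text \<open>
  The quotient is not the zero ring: \<open>e\<^sub>i\<close> acts on functions of finite sets of naturals,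
  and this action annihilates the ideal but not \<open>1\<close>.
\<close>

definition flip_sign :: "nat \<Rightarrow> nat set \<Rightarrow> real" where
  "flip_sign i A = (if i \<in> A then 1 else - 1) * (\<Prod>j<i. if j \<in> A then - 1 else 1)"

definition flip :: "nat \<Rightarrow> nat set \<Rightarrow> nat set" where
  "flip i A = (if i \<in> A then A - {i} else insert i A)"

definition letter_action :: "nat \<Rightarrow> (nat set \<Rightarrow> real) \<Rightarrow> nat set \<Rightarrow> real" where
  "letter_action i f A = flip_sign i A * f (flip i A)"

definition word_action :: "'n::len0 clifford_word \<Rightarrow> (nat set \<Rightarrow> real) \<Rightarrow> nat set \<Rightarrow> real" where
  "word_action w = foldr letter_action (Rep_clifford_word w)"

definition action :: "('n::len0 clifford_word \<Rightarrow>\<^sub>0 real) \<Rightarrow> (nat set \<Rightarrow> real) \<Rightarrow> nat set \<Rightarrow> real" where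
  "action p f A = (\<Sum>w\<in>Poly_Mapping.keys p. Poly_Mapping.lookup p w * word_action w f A)"

lemma flip_sign_flip_self: "flip_sign i (flip i A) = - flip_sign i A"
proof -
  have "(\<Prod>j<i. if j \<in> flip i A then - 1 else (1::real)) = (\<Prod>j<i. if j \<in> A then - 1 else 1)"
    by (rule prod.cong) (auto simp: flip_def)
  then show ?thesis by (auto simp: flip_sign_def flip_def)
qed

lemma flip_sign_flip_less: "i < j \<Longrightarrow> flip_sign i (flip j A) = flip_sign i A"
proof -
  assume "i < j"
  then have "(\<Prod>k<i. if k \<in> flip j A then - 1 else (1::real)) = (\<Prod>k<i. if k \<in> A then - 1 else 1)"
    by (intro prod.cong) (auto simp: flip_def)
  with \<open>i < j\<close> show ?thesis by (auto simp: flip_sign_def flip_def)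
qed

lemma flip_sign_flip_greater: "i < j \<Longrightarrow> flip_sign j (flip i A) = - flip_sign j A"
proof -
  assume "i < j"
  have "(\<Prod>k\<in>{..<j} - {i}. if k \<in> flip i A then - 1 else (1::real)) =
      (\<Prod>k\<in>{..<j} - {i}. if k \<in> A then - 1 else 1)"
    by (rule prod.cong) (auto simp: flip_def)
  with \<open>i < j\<close> show ?thesis
    by (auto simp: flip_sign_def flip_def prod.remove[of "{..<j}" i])
qed

lemma flip_sign_square: "flip_sign i A * flip_sign i A = 1"
proof -
  have "(\<Prod>j<i. if j \<in> A then - 1 else (1::real)) * (\<Prod>j<i. if j \<in> A then - 1 else 1) = 1"
    unfolding prod.distrib[symmetric] by (rule prod.neutral) auto
  then show ?thesis by (auto simp: flip_sign_def)
qed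

lemma flip_flip: "flip i (flip i A) = A" "flip i (flip j A) = flip j (flip i A)"
  by (auto simp: flip_def)

lemma letter_action_anticommute:
  "letter_action i (letter_action j f) A + letter_action j (letter_action i f) A
    + (if i = j then 2 else 0) * f A = 0"
proof (cases i j rule: linorder_cases)
  case equal
  then show ?thesis
    by (simp add: letter_action_def flip_sign_flip_self flip_flip mult.assoc[symmetric] flip_sign_square)
qed (simp_all add: letter_action_def flip_sign_flip_less flip_sign_flip_greater flip_flip(2)[of i j])

lemma letter_action_linear:
  "letter_action i (\<lambda>A. c * f A + d * g A) = (\<lambda>A. c * letter_action i f A + d * letter_action i g A)"
  by (rule ext) (simp add: letter_action_def algebra_simps)

lemma word_action_linear:
  "word_action w (\<lambda>A. c * f A + d * g A) = (\<lambda>A. c * word_action w f A + d * word_action w g A)"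
proof -
  have "foldr letter_action l (\<lambda>A. c * f A + d * g A) =
      (\<lambda>A. c * foldr letter_action l f A + d * foldr letter_action l g A)" for l
    by (induction l) (simp_all add: letter_action_linear)
  then show ?thesis by (simp add: word_action_def)
qed

lemma word_action_plus: "word_action (v + w) f = word_action v (word_action w f)"
  by (simp add: word_action_def plus_clifford_word.rep_eq)

lemma action_zero [simp]: "action 0 f A = 0"
  by (simp add: action_def)

lemma action_single: "action (Poly_Mapping.single w c) f A = c * word_action w f A"
  by (simp add: action_def)

lemma action_add: "action (p + q) f A = action p f A + action q f A"
  unfolding action_def by (rule setsum_keys_plus_distrib) (simp_all add: algebra_simps)

lemma action_mult: "action (p * q) f = action p (action q f)"
proof -
  have 0: "word_action v (\<lambda>A. 0) A = 0" for v :: "'a clifford_word" and A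
    using word_action_linear[of v 0 "\<lambda>A. 0" 0 "\<lambda>A. 0"] by (simp add: fun_eq_iff)
  have 1: "action (Poly_Mapping.single v c * q) f A = action (Poly_Mapping.single v c) (action q f) A"
    for v c A
  proof (induction q arbitrary: A rule: poly_mapping_single_induct)
    case zero
    have "action 0 f = (\<lambda>A. 0)" by (rule ext) simp
    then show ?case by (simp add: action_single 0)
  next
    case (add q w d)
    have *: "action (Poly_Mapping.single w d + q) f = (\<lambda>A. d * word_action w f A + 1 * action q f A)"
      by (rule ext) (simp add: action_add action_single)
    show ?case
      unfolding * action_single word_action_linear
      by (simp add: distrib_left action_add add.IH mult_single action_single word_action_plus)
  qed
  show ?thesis
  proof (rule ext)
    show "action (p * q) f A = action p (action q f) A" for A
      by (induction p rule: poly_mapping_single_induct) (simp_all add: distrib_right action_add 1)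
  qed
qed

lemma word_action_letter:
  "i \<in> {1..LENGTH('n::len0)} \<Longrightarrow> word_action (Abs_clifford_word [i] :: 'n clifford_word) = letter_action i"
  by (simp add: word_action_def Abs_clifford_word_inverse fun_eq_iff)

lemma word_action_zero: "word_action 0 f = f"
  by (simp add: word_action_def zero_clifford_word.rep_eq)

lemma action_clifford_ideal: "x \<in> clifford_ideal \<Longrightarrow> action x f A = 0"
proof (induction arbitrary: f A rule: clifford_ideal.induct)
  case (relation i j)
  have act: "action (generator k :: 'a clifford_word \<Rightarrow>\<^sub>0 real) g = letter_action k g"
    if "k \<in> {1..LENGTH('a)}" for k g
    using word_action_letter[OF that] by (simp add: generator_def action_single fun_eq_iff)
  have two: "action (if i = j then 2 else 0 :: 'a clifford_word \<Rightarrow>\<^sub>0 real) f A = (if i = j then 2 else 0) * f A"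
    using action_single[of "0 :: 'a clifford_word" 2 f A] by (simp add: word_action_zero)
  show ?case
    unfolding action_add action_mult act[OF relation(1)] act[OF relation(2)] two
    by (rule letter_action_anticommute)
next
  case (mult_left x a)
  then have *: "action x f = (\<lambda>A. 0)" by (simp add: fun_eq_iff)
  have "action a (\<lambda>A. 0) A = 0"
    by (simp add: action_def word_action_linear[of _ 0 "\<lambda>A. 0" 0 "\<lambda>A. 0", simplified])
  then show ?case by (simp add: action_mult *)
qed (simp_all add: action_add action_mult)

lemma one_notin_clifford_ideal: "1 \<notin> clifford_ideal"
proof
  assume "1 \<in> (clifford_ideal :: ('a::len0 clifford_word \<Rightarrow>\<^sub>0 real) set)"
  then have "action (1 :: 'a clifford_word \<Rightarrow>\<^sub>0 real) (\<lambda>A. 1) {} = 0"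
    by (rule action_clifford_ideal)
  then show False
    using action_single[of "0 :: 'a clifford_word" 1 "\<lambda>A. 1" "{}"] by (simp add: word_action_zero)
qed

lemma single_zero_commute:
  fixes p :: "'n::len0 clifford_word \<Rightarrow>\<^sub>0 real"
  shows "Poly_Mapping.single 0 r * p = p * Poly_Mapping.single 0 r"
  by (induction p rule: poly_mapping_single_induct) (simp_all add: algebra_simps mult_single)

definition clifford_rel ::
    "('n::len0 clifford_word \<Rightarrow>\<^sub>0 real) \<Rightarrow> ('n clifford_word \<Rightarrow>\<^sub>0 real) \<Rightarrow> bool" where
  "clifford_rel x y \<longleftrightarrow> x - y \<in> clifford_ideal"

lemma clifford_rel_trans: "clifford_rel x y \<Longrightarrow> clifford_rel y z \<Longrightarrow> clifford_rel x z"
  using clifford_ideal.add[of "x - y" "y - z"] by (simp add: clifford_rel_def)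

quotient_type (overloaded) 'n clifford = "'n::len0 clifford_word \<Rightarrow>\<^sub>0 real" / clifford_rel
proof (rule equivpI)
  show "reflp clifford_rel"
    by (rule reflpI) (simp add: clifford_rel_def clifford_ideal.zero)
  show "symp clifford_rel"
    by (rule sympI) (metis clifford_rel_def clifford_ideal_uminus minus_diff_eq)
  show "transp clifford_rel"
    by (rule transpI) (rule clifford_rel_trans)
qed

instantiation clifford :: (len0) real_algebra_1
begin

lift_definition zero_clifford :: "'a clifford" is 0 .

lift_definition one_clifford :: "'a clifford" is 1 .

lift_definition plus_clifford :: "'a clifford \<Rightarrow> 'a clifford \<Rightarrow> 'a clifford" is "(+)"
  unfolding clifford_rel_def add_diff_add by (rule clifford_ideal.add)

lift_definition minus_clifford :: "'a clifford \<Rightarrow> 'a clifford \<Rightarrow> 'a clifford" is "(-)"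
proof -
  fix a b c d :: "'a clifford_word \<Rightarrow>\<^sub>0 real"
  assume "clifford_rel a b" "clifford_rel c d"
  then have "(a - b) - (c - d) \<in> clifford_ideal"
    unfolding clifford_rel_def by (rule clifford_ideal_diff)
  then show "clifford_rel (a - c) (b - d)"
    by (simp add: clifford_rel_def algebra_simps)
qed

lift_definition uminus_clifford :: "'a clifford \<Rightarrow> 'a clifford" is uminus
  unfolding clifford_rel_def minus_diff_minus by (rule clifford_ideal_uminus)

lift_definition times_clifford :: "'a clifford \<Rightarrow> 'a clifford \<Rightarrow> 'a clifford" is "(*)"
proof -
  fix a b c d :: "'a clifford_word \<Rightarrow>\<^sub>0 real"
  assume "clifford_rel a b" "clifford_rel c d"
  then have "(a - b) * c + b * (c - d) \<in> clifford_ideal"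
    unfolding clifford_rel_def
    by (intro clifford_ideal.add clifford_ideal.mult_left clifford_ideal.mult_right)
  then show "clifford_rel (a * c) (b * d)"
    by (simp add: clifford_rel_def algebra_simps)
qed

lift_definition scaleR_clifford :: "real \<Rightarrow> 'a clifford \<Rightarrow> 'a clifford"
  is "\<lambda>r x. Poly_Mapping.single 0 r * x"
  unfolding clifford_rel_def
  unfolding right_diff_distrib[symmetric] by (rule clifford_ideal.mult_left)

instance
proof
  have eq: "clifford_rel x y" if "x = y" for x y :: "'a clifford_word \<Rightarrow>\<^sub>0 real"
    using that by (simp add: clifford_rel_def clifford_ideal.zero)
  fix a b c :: "'a clifford" and r s :: real
  show "a + b + c = a + (b + c)" by transfer (rule eq, simp add: add.assoc)
  show "a + b = b + a" by transfer (rule eq, simp add: add.commute)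
  show "0 + a = a" by transfer (rule eq, simp)
  show "- a + a = 0" by transfer (rule eq, simp)
  show "a - b = a + - b" by transfer (rule eq, simp)
  show "a * b * c = a * (b * c)" by transfer (rule eq, simp add: mult.assoc)
  show "(a + b) * c = a * c + b * c" by transfer (rule eq, simp add: distrib_right)
  show "a * (b + c) = a * b + a * c" by transfer (rule eq, simp add: distrib_left)
  show "1 * a = a" by transfer (rule eq, simp)
  show "a * 1 = a" by transfer (rule eq, simp)
  show "(0 :: 'a clifford) \<noteq> 1"
    by transfer (use clifford_ideal_uminus[of "- 1"] one_notin_clifford_ideal in \<open>auto simp: clifford_rel_def\<close>)
  show "r *\<^sub>R (a + b) = r *\<^sub>R a + r *\<^sub>R b" by transfer (rule eq, simp add: distrib_left)
  show "(r + s) *\<^sub>R a = r *\<^sub>R a + s *\<^sub>R a" by transfer (rule eq, simp add: single_add distrib_right)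
  show "r *\<^sub>R s *\<^sub>R a = (r * s) *\<^sub>R a"
    by transfer (rule eq, simp add: mult.assoc[symmetric] mult_single)
  show "1 *\<^sub>R a = a" by transfer (rule eq, simp)
  show "r *\<^sub>R a * b = r *\<^sub>R (a * b)" by transfer (rule eq, simp add: mult.assoc)
  show "a * r *\<^sub>R b = r *\<^sub>R (a * b)"
    by transfer (rule eq, simp only: single_zero_commute mult.assoc)
qed

end

lift_definition basis_vector :: "nat \<Rightarrow> 'n::len0 clifford" is generator .

lemma basis_vector_anticommute:
  assumes "i \<in> {1..LENGTH('n::len0)}" "j \<in> {1..LENGTH('n)}"
  shows "basis_vector i * basis_vector j + basis_vector j * basis_vector i
    = (if i = j then - 2 else 0 :: 'n clifford)"
proof -
  have "basis_vector i * basis_vector j + basis_vector j * basis_vector i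
      + (if i = j then 1 + 1 else 0) = (0 :: 'n clifford)"
    using assms
    by transfer (use clifford_ideal.relation in \<open>fastforce simp: clifford_rel_def one_add_one\<close>)
  then show ?thesis by (auto simp: eq_neg_iff_add_eq_0)
qed

section \<open>Paravectors and the symmetrized product\<close>

text \<open>
  \<open>S \<oplus> V = span(e\<^sub>0, e\<^sub>1, \<dots>, e\<^sub>n)\<close> with \<open>e\<^sub>0 = 1\<close>.
\<close>

definition paravectors :: "'n::len0 clifford set" where
  "paravectors = span (insert 1 (basis_vector ` {1..LENGTH('n)}))"

text \<open>
  Tuples in \<open>P\<^sup>l\<close> are functions in \<open>{1..l} \<rightarrow>\<^sub>E P\<close>.
\<close>

definition multilinear_on :: "nat \<Rightarrow> 'a::real_vector set \<Rightarrow> ((nat \<Rightarrow> 'a) \<Rightarrow> 'b::real_vector) \<Rightarrow> bool" where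
  "multilinear_on l P F \<longleftrightarrow> (\<forall>u \<in> {1..l} \<rightarrow>\<^sub>E P. \<forall>k \<in> {1..l}.
     (\<forall>x\<in>P. \<forall>y\<in>P. F (u(k := x + y)) = F (u(k := x)) + F (u(k := y))) \<and>
     (\<forall>c. \<forall>x\<in>P. F (u(k := c *\<^sub>R x)) = c *\<^sub>R F (u(k := x))))"

definition symmetric_on :: "nat \<Rightarrow> 'a set \<Rightarrow> ((nat \<Rightarrow> 'a) \<Rightarrow> 'b) \<Rightarrow> bool" where
  "symmetric_on l P F \<longleftrightarrow> (\<forall>u \<in> {1..l} \<rightarrow>\<^sub>E P. \<forall>\<sigma>. \<sigma> permutes {1..l} \<longrightarrow> F (u \<circ> \<sigma>) = F u)"

definition symmetrized_product :: "nat \<Rightarrow> (nat \<Rightarrow> 'a::real_algebra_1) \<Rightarrow> 'a" where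
  "symmetrized_product l u =
     (1 / fact l) *\<^sub>R (\<Sum>\<sigma> | \<sigma> permutes {1..l}. prod_list (map (\<lambda>i. u (\<sigma> i)) [1..<Suc l]))"

end

(* Since basis vectors anticommute up to scalars, a vector v squares to a scalar, so every power of
   a paravector s + v lies in span {1, v}. By Moebius inversion over the sets of letters occurring
   in a word, the symmetrized product is a linear combination of the l-th powers of the partial
   sums of u 1, ..., u l, and such powers are paravectors. *)

theory Submission
  imports Defs "HOL-Combinatorics.Multiset_Permutations"
begin

text \<open>Lets the sum over permutations be read as a sum over words that use each letter of
  \<open>{1..l}\<close> exactly once. In this form single factors can be isolated, and powers of
  sums expand into words.\<close>

lemma bij_betw_permutes_permutations_of_set:
  "bij_betw (\<lambda>\<sigma>. map \<sigma> [1..<Suc l]) {\<sigma>. \<sigma> permutes {1..l}} (permutations_of_set {1..l})"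
proof (rule bij_betw_imageI)
  show inj: "inj_on (\<lambda>\<sigma>. map \<sigma> [1..<Suc l]) {\<sigma>. \<sigma> permutes {1..l}}"
  proof (rule inj_onI, rule ext)
    fix \<sigma> \<tau> :: "nat \<Rightarrow> nat" and i
    assume "\<sigma> \<in> {\<sigma>. \<sigma> permutes {1..l}}" "\<tau> \<in> {\<sigma>. \<sigma> permutes {1..l}}"
      and eq: "map \<sigma> [1..<Suc l] = map \<tau> [1..<Suc l]"
    then have "\<sigma> i = \<tau> i" if "i \<in> {1..l}"
      using that by (simp only: map_eq_conv set_upt atLeastLessThanSuc_atLeastAtMost)
    \<comment> \<open>The lists do not see these points, but both permutations fix them.\<close>
    moreover have "\<sigma> i = \<tau> i" if "i \<notin> {1..l}"
      using that \<open>\<sigma> \<in> _\<close> \<open>\<tau> \<in> _\<close> by (simp add: permutes_not_in)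
    ultimately show "\<sigma> i = \<tau> i" by blast
  qed
  show "(\<lambda>\<sigma>. map \<sigma> [1..<Suc l]) ` {\<sigma>. \<sigma> permutes {1..l}} = permutations_of_set {1..l}"
  \<comment> \<open>Surjectivity by counting: an injective image with l! elements inside a set of l!
    elements.\<close>
  proof (rule card_subset_eq)
    have "[1..<Suc l] \<in> permutations_of_set {1..l}"
      by (intro permutations_of_setI) (simp_all only: set_upt atLeastLessThanSuc_atLeastAtMost distinct_upt)
    then show "(\<lambda>\<sigma>. map \<sigma> [1..<Suc l]) ` {\<sigma>. \<sigma> permutes {1..l}} \<subseteq> permutations_of_set {1..l}"
      using permutations_of_set_image_permutes by blast
    show "card ((\<lambda>\<sigma>. map \<sigma> [1..<Suc l]) ` {\<sigma>. \<sigma> permutes {1..l}})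
        = card (permutations_of_set {1..l})"
      by (subst card_image[OF inj]) (simp add: card_permutations)
  qed simp
qed

lemma symmetrized_product_altdef:
  "symmetrized_product l u =
     (1 / fact l) *\<^sub>R (\<Sum>xs\<in>permutations_of_set {1..l}. prod_list (map u xs))"
  unfolding symmetrized_product_def
    sum.reindex_bij_betw[OF bij_betw_permutes_permutations_of_set, symmetric]
  by (simp add: o_def)

text \<open>The letter \<open>k\<close> occurs exactly once, so the factors before and after it do
  not see the update. Since \<open>a\<close> and \<open>b\<close> are independent of
  \<open>x\<close>, additivity and homogeneity in slot \<open>k\<close> follow from bilinearity of
  the product.\<close>

lemma prod_list_map_upd_distinct:
  fixes u :: "'i \<Rightarrow> 'a::monoid_mult"
  assumes "distinct xs" "k \<in> set xs"
  shows "\<exists>a b. \<forall>x. prod_list (map (u(k := x)) xs) = a * x * b"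
proof -
  obtain ys zs where xs: "xs = ys @ k # zs"
    using split_list[OF assms(2)] by blast
  have "map (u(k := x)) ys = map u ys" "map (u(k := x)) zs = map u zs" for x
    using assms(1) xs by auto
  then have "prod_list (map (u(k := x)) xs) = prod_list (map u ys) * x * prod_list (map u zs)" for x
    by (simp add: xs mult.assoc del: map_eq_conv map_fun_upd)
  then show ?thesis by blast
qed

lemma multilinear_on_symmetrized_product: "multilinear_on l P (symmetrized_product l)"
  unfolding multilinear_on_def
proof (intro ballI conjI allI)
  fix u :: "nat \<Rightarrow> 'a" and k assume k: "k \<in> {1..l}"
  have add: "prod_list (map (u(k := x + y)) xs)
        = prod_list (map (u(k := x)) xs) + prod_list (map (u(k := y)) xs)"
    and scale: "prod_list (map (u(k := c *\<^sub>R x)) xs) = c *\<^sub>R prod_list (map (u(k := x)) xs)"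
    if "xs \<in> permutations_of_set {1..l}" for xs x y c
  proof -
    have "distinct xs" "k \<in> set xs"
      using permutations_of_setD[OF that] k by simp_all
    from prod_list_map_upd_distinct[OF this, of u]
    obtain a b where "\<forall>x. prod_list (map (u(k := x)) xs) = a * x * b"
      by (elim exE)
    then show "prod_list (map (u(k := x + y)) xs)
        = prod_list (map (u(k := x)) xs) + prod_list (map (u(k := y)) xs)"
      and "prod_list (map (u(k := c *\<^sub>R x)) xs) = c *\<^sub>R prod_list (map (u(k := x)) xs)"
      by (simp_all add: algebra_simps)
  qed
  show "symmetrized_product l (u(k := x + y))
      = symmetrized_product l (u(k := x)) + symmetrized_product l (u(k := y))" for x y
    by (simp add: symmetrized_product_altdef add sum.distrib scaleR_add_right)
  show "symmetrized_product l (u(k := c *\<^sub>R x)) = c *\<^sub>R symmetrized_product l (u(k := x))" for c x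
    by (simp add: symmetrized_product_altdef scale scaleR_sum_right[symmetric] mult.commute)
qed

lemma symmetric_on_symmetrized_product: "symmetric_on l P (symmetrized_product l)"
  unfolding symmetric_on_def
proof (intro ballI allI impI)
  fix u :: "nat \<Rightarrow> 'a" and \<sigma> assume \<sigma>: "\<sigma> permutes {1..l}"
  \<comment> \<open>Renaming letters by \<sigma> maps the arrangements of \<open>{1..l}\<close>
    bijectively onto themselves, so it only reorders the sum.\<close>
  have "inj_on (map \<sigma>) (permutations_of_set {1..l})"
    using permutes_inj[OF \<sigma>] by (simp add: inj_on_def)
  then have "(\<Sum>xs\<in>permutations_of_set {1..l}. prod_list (map u (map \<sigma> xs)))
      = (\<Sum>xs\<in>permutations_of_set {1..l}. prod_list (map u xs))"
    by (subst (2) permutations_of_set_image_permutes[OF \<sigma>, symmetric])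
      (simp add: sum.reindex o_def)
  then show "symmetrized_product l (u \<circ> \<sigma>) = symmetrized_product l u"
    by (simp add: symmetrized_product_altdef)
qed

text \<open>Expanding the power without commutativity: choosing one summand from each of the
  \<open>n\<close> factors, in order, gives a word of length \<open>n\<close>.\<close>

lemma sum_power_eq_sum_lists:
  fixes u :: "'i \<Rightarrow> 'a::semiring_1"
  assumes "finite A"
  shows "(\<Sum>i\<in>A. u i) ^ n = (\<Sum>xs | set xs \<subseteq> A \<and> length xs = n. prod_list (map u xs))"
proof (induction n)
  case 0
  have "{xs. set xs \<subseteq> A \<and> length xs = 0} = {[]}" by auto
  then show ?case by simp
next
  case (Suc n)
  let ?L = "{xs. set xs \<subseteq> A \<and> length xs = n}"
  have "inj_on (\<lambda>(xs, x). x # xs) (?L \<times> A)" by (auto simp: inj_on_def)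
  then have "(\<Sum>xs | set xs \<subseteq> A \<and> length xs = Suc n. prod_list (map u xs))
      = (\<Sum>(xs, x)\<in>?L \<times> A. u x * prod_list (map u xs))"
    unfolding lists_length_Suc_eq by (simp add: sum.reindex case_prod_unfold)
  also have "\<dots> = (\<Sum>xs\<in>?L. \<Sum>x\<in>A. u x * prod_list (map u xs))"
    by (simp add: sum.cartesian_product)
  also have "\<dots> = (\<Sum>i\<in>A. u i) * (\<Sum>xs\<in>?L. prod_list (map u xs))"
    by (subst sum.swap) (simp add: sum_product)
  finally show ?case by (simp add: Suc.IH)
qed

text \<open>Noncommutative polarization identity. Grouping words by their exact set of letters
  writes the power of each partial sum as a sum over subsets; inverting this at \<open>A\<close>
  isolates the words that use every letter.\<close>

lemma polarization:
  fixes u :: "'i \<Rightarrow> 'a::ring_1"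
  assumes "finite A"
  shows "(\<Sum>xs\<in>permutations_of_set A. prod_list (map u xs))
    = (\<Sum>T\<in>Pow A. (- 1) ^ (card A - card T) * (\<Sum>i\<in>T. u i) ^ card A)"
proof -
  \<comment> \<open>The length stays \<open>card A\<close> for every \<open>T\<close>, so that one
    \<open>f\<close> serves the powers of all partial sums.\<close>
  define f where "f T = (\<Sum>xs | set xs = T \<and> length xs = card A. prod_list (map u xs))" for T
  have "(\<Sum>i\<in>S. u i) ^ card A = (\<Sum>T\<in>Pow S. f T)" if "finite S" for S
  proof -
    have "{xs \<in> {xs. set xs \<subseteq> S \<and> length xs = card A}. set xs = T}
        = {xs. set xs = T \<and> length xs = card A}" if "T \<in> Pow S" for T
      using that by auto
    moreover have "(\<Sum>xs | set xs \<subseteq> S \<and> length xs = card A. prod_list (map u xs))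
        = (\<Sum>T\<in>Pow S. \<Sum>xs | xs \<in> {xs. set xs \<subseteq> S \<and> length xs = card A} \<and> set xs = T.
            prod_list (map u xs))"
      using that by (intro sum.group[symmetric] finite_lists_length_eq) auto
    ultimately show ?thesis
      by (simp add: sum_power_eq_sum_lists[OF that] f_def)
  qed
  then have "f A = (\<Sum>T\<in>Pow A. (- 1) ^ (card A - card T) * (\<Sum>i\<in>T. u i) ^ card A)"
    using assms by (rule inclusion_exclusion_mobius)
  \<comment> \<open>A word with as many positions as distinct letters repeats none.\<close>
  moreover have "{xs. set xs = A \<and> length xs = card A} = permutations_of_set A"
    by (auto simp: length_finite_permutations_of_set dest: permutations_of_setD
        intro!: permutations_of_setI card_distinct)
  ultimately show ?thesis by (simp add: f_def)
qed

text \<open>The anticommutator is bilinear, so the condition on \<open>B\<close> extends to its span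
  one argument at a time.\<close>

lemma anticommutator_span:
  fixes B :: "'a::real_algebra_1 set"
  assumes B: "\<And>x y. x \<in> B \<Longrightarrow> y \<in> B \<Longrightarrow> x * y + y * x \<in> span {1}"
    and "v \<in> span B" "w \<in> span B"
  shows "v * w + w * v \<in> span {1}"
proof -
  \<comment> \<open>Used twice: first with \<open>z\<close> an element of \<open>B\<close> and
    \<open>y\<close> = \<open>v\<close>, then with \<open>z\<close> = \<open>v\<close> and
    \<open>y\<close> = \<open>w\<close>.\<close>
  have ind: "z * y + y * z \<in> span {1}"
    if "y \<in> span B" and base: "\<And>x. x \<in> B \<Longrightarrow> z * x + x * z \<in> span {1}" for y z
    using that(1)
  proof (induction rule: span_induct_alt)
    case base
    then show ?case by (simp add: span_zero)
  next
    case (step c x y)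
    have "z * (c *\<^sub>R x + y) + (c *\<^sub>R x + y) * z = c *\<^sub>R (z * x + x * z) + (z * y + y * z)"
      by (simp add: algebra_simps)
    then show ?case
      using step base by (simp only: span_add span_scale)
  qed
  have "v * x + x * v \<in> span {1}" if "x \<in> B" for x
    using ind[OF \<open>v \<in> span B\<close>, of x] B[OF that] by (simp add: add.commute)
  with ind[OF \<open>w \<in> span B\<close>] show ?thesis by blast
qed

lemma power_mem_span_insert_one:
  fixes B :: "'a::real_algebra_1 set"
  assumes B: "\<And>x y. x \<in> B \<Longrightarrow> y \<in> B \<Longrightarrow> x * y + y * x \<in> span {1}"
    and x: "x \<in> span (insert 1 B)"
  shows "x ^ n \<in> span (insert 1 B)"
proof -
  obtain s where v: "x - s *\<^sub>R 1 \<in> span B"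
    using x by (auto simp: span_insert)
  define v where "v = x - s *\<^sub>R 1"
  \<comment> \<open>The anticommutator of \<open>v\<close> with itself is twice its square.\<close>
  have "(1 / 2) *\<^sub>R (v * v + v * v) \<in> span {1}"
    using anticommutator_span[OF B v v] by (intro span_scale) (simp add: v_def)
  then have "v * v \<in> span {1}"
    by (simp add: scaleR_2[symmetric])
  then obtain q where q: "v * v = q *\<^sub>R 1"
    by (auto simp: span_singleton)
  have "\<exists>a b. x ^ n = a *\<^sub>R 1 + b *\<^sub>R v"
  proof (induction n)
    case 0
    have "x ^ 0 = 1 *\<^sub>R 1 + 0 *\<^sub>R v" by simp
    then show ?case by blast
  next
    case (Suc n)
    then obtain a b where "x ^ n = a *\<^sub>R 1 + b *\<^sub>R v" by blast
    then have "x ^ Suc n = (s *\<^sub>R 1 + v) * (a *\<^sub>R 1 + b *\<^sub>R v)"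
      by (simp add: v_def)
    \<comment> \<open>The term \<open>b * q\<close> comes from replacing \<open>v * v\<close> by the
      scalar \<open>q\<close>; thus multiplication by \<open>x\<close> preserves the span of 1 and
      \<open>v\<close>.\<close>
    also have "\<dots> = (s * a + b * q) *\<^sub>R 1 + (s * b + a) *\<^sub>R v"
      by (simp add: algebra_simps q)
    finally show ?case by blast
  qed
  moreover have "v \<in> span (insert 1 B)"
    using v span_mono[of B "insert 1 B"] by (auto simp: v_def)
  ultimately show ?thesis
    by (metis span_add span_scale span_base insertI1)
qed

lemma power_mem_paravectors:
  fixes x :: "'n::len0 clifford"
  assumes "x \<in> paravectors"
  shows "x ^ k \<in> paravectors"
  unfolding paravectors_def
proof (rule power_mem_span_insert_one)
  show "x \<in> span (insert 1 (basis_vector ` {1..LENGTH('n)}))"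
    using assms by (simp add: paravectors_def)
  fix y z :: "'n clifford"
  assume "y \<in> basis_vector ` {1..LENGTH('n)}" "z \<in> basis_vector ` {1..LENGTH('n)}"
  then obtain i j where "y = basis_vector i" "z = basis_vector j"
    "i \<in> {1..LENGTH('n)}" "j \<in> {1..LENGTH('n)}"
    by blast
  \<comment> \<open>The Clifford relation, with its constant written as a real multiple of 1 to
    exhibit membership in \<open>span {1}\<close>.\<close>
  then have "y * z + z * y = (if i = j then - 2 else 0) *\<^sub>R 1"
    using basis_vector_anticommute[of i j, where 'n = 'n] by (auto simp: scaleR_2)
  then show "y * z + z * y \<in> span {1}"
    by (simp only: span_scale span_base insertI1)
qed

lemma symmetrized_product_mem_paravectors:
  assumes "u \<in> {1..l} \<rightarrow> (paravectors :: 'n::len0 clifford set)"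
  shows "symmetrized_product l u \<in> paravectors"
proof -
  have sub: "subspace (paravectors :: 'n clifford set)"
    by (simp add: paravectors_def)
  \<comment> \<open>Paravectors are not closed under products in general, but each term of the
    polarization identity is a single power up to sign.\<close>
  have "(- 1) ^ (l - card T) * (\<Sum>i\<in>T. u i) ^ l \<in> paravectors" if "T \<in> Pow {1..l}" for T
  proof -
    have "(\<Sum>i\<in>T. u i) \<in> paravectors"
      using that assms by (intro subspace_sum[OF sub]) auto
    then have "(\<Sum>i\<in>T. u i) ^ l \<in> paravectors"
      by (rule power_mem_paravectors)
    \<comment> \<open>The sign is an algebra element rather than a real scalar, so it is resolved by
      parity and closure under negation.\<close>
    then show ?thesis
      by (simp add: minus_one_power_iff subspace_neg[OF sub])
  qed
  then have "(\<Sum>T\<in>Pow {1..l}. (- 1) ^ (l - card T) * (\<Sum>i\<in>T. u i) ^ l) \<in> paravectors"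
    by (rule subspace_sum[OF sub])
  then show ?thesis
    by (simp add: symmetrized_product_altdef polarization subspace_scale[OF sub])
qed

theorem mainTheorem1:
  fixes l :: nat
  assumes "l \<ge> 1"
  shows "multilinear_on l (paravectors :: 'n::len0 clifford set) (symmetrized_product l)
    \<and> symmetric_on l (paravectors :: 'n clifford set) (symmetrized_product l)
    \<and> (\<forall>u \<in> {1..l} \<rightarrow>\<^sub>E (paravectors :: 'n clifford set). symmetrized_product l u \<in> paravectors)"
  by (auto simp: PiE_iff intro!: multilinear_on_symmetrized_product symmetric_on_symmetrized_product
      symmetrized_product_mem_paravectors)

end
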